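(* Let $P(3n,n)$ be a generalized Petersen graph. If $n \geq 2$, then $\chi'_{\mathrm{star}}(P(3n,n)) = 5$.
   Context: All graphs are simple, finite and undirected. The generalized Petersen graph $P(m,n)$ is the graph of order $2m$ with vertex set $\{u_1, \dots, u_m, v_1, \dots, v_m\}$ and edge set $\{u_iu_{i+1}, v_iv_{i+n}, u_iv_i : i = 1, \dots, m\}$, where addition of subscripts is taken modulo $m$. A star $k$-edge-coloring of a graph $G$ is a proper edge-coloring of $G$ with $k$ colors such that no path of length four and no cycle of length four in $G$ (length = number of edges) is bicolored, i.e., at least three colors appear on every path or cycle of length four. The star chromatic index $\chi_{\mathrm{star}}'(G)$ is the smallest $k$ such that $G$ has a star $k$-edge-coloring. *)

theory Defs
  imports Main
begin

record 'a graph =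
  verts :: "'a set"
  edges :: "'a set set"

definition simple_graph :: "('a, 'b) graph_scheme \<Rightarrow> bool" where
  "simple_graph G \<longleftrightarrow>
     finite (verts G) \<and> (\<forall>e\<in>edges G. e \<subseteq> verts G \<and> card e = 2)"

text \<open>A path of length \<open>l\<close> is the list of its \<open>l + 1\<close> distinct vertices; a cycle of length
  \<open>l \<ge> 3\<close> is the list of its \<open>l\<close> distinct vertices, the last one being adjacent to the first.
  Membership in \<open>verts\<close> needs no separate condition in a simple graph once \<open>l \<ge> 1\<close>, but is
  included so that the trivial path is covered.\<close>

definition is_path :: "('a, 'b) graph_scheme \<Rightarrow> 'a list \<Rightarrow> bool" where
  "is_path G p \<longleftrightarrow> p \<noteq> [] \<and> distinct p \<and> set p \<subseteq> verts G \<and>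
     (\<forall>i. Suc i < length p \<longrightarrow> {p ! i, p ! Suc i} \<in> edges G)"

definition path_edges :: "'a list \<Rightarrow> 'a set set" where
  "path_edges p = {{p ! i, p ! Suc i} | i. Suc i < length p}"

definition is_cycle :: "('a, 'b) graph_scheme \<Rightarrow> 'a list \<Rightarrow> bool" where
  "is_cycle G p \<longleftrightarrow> 3 \<le> length p \<and> is_path G p \<and> {last p, hd p} \<in> edges G"

definition cycle_edges :: "'a list \<Rightarrow> 'a set set" where
  "cycle_edges p = insert {last p, hd p} (path_edges p)"

definition proper_edge_coloring :: "('a, 'b) graph_scheme \<Rightarrow> ('a set \<Rightarrow> 'c) \<Rightarrow> bool" where
  "proper_edge_coloring G c \<longleftrightarrow>
     (\<forall>e\<in>edges G. \<forall>f\<in>edges G. e \<noteq> f \<and> e \<inter> f \<noteq> {} \<longrightarrow> c e \<noteq> c f)"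

text \<open>Colors are the numbers below \<open>k\<close>, not all of which have to be used.\<close>

definition star_edge_coloring :: "('a, 'b) graph_scheme \<Rightarrow> nat \<Rightarrow> ('a set \<Rightarrow> nat) \<Rightarrow> bool" where
  "star_edge_coloring G k c \<longleftrightarrow>
     c ` edges G \<subseteq> {..<k} \<and> proper_edge_coloring G c \<and>
     (\<forall>p. is_path G p \<and> length p = 5 \<longrightarrow> 3 \<le> card (c ` path_edges p)) \<and>
     (\<forall>p. is_cycle G p \<and> length p = 4 \<longrightarrow> 3 \<le> card (c ` cycle_edges p))"

definition star_chromatic_index :: "('a, 'b) graph_scheme \<Rightarrow> nat" where
  "star_chromatic_index G = (LEAST k. \<exists>c. star_edge_coloring G k c)"

text \<open>The vertices \<open>U i\<close> and \<open>V i\<close> have subscripts in \<open>{0, \<dots>, m - 1}\<close>, the residues modulo \<open>m\<close>;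
  the residue \<open>0\<close> stands for the subscript \<open>m\<close>.\<close>

datatype petersen_vertex = U nat | V nat

definition generalized_petersen :: "nat \<Rightarrow> nat \<Rightarrow> petersen_vertex graph" where
  "generalized_petersen m n =
     \<lparr> verts = U ` {..<m} \<union> V ` {..<m},
       edges = {{U i, U ((i + 1) mod m)} | i. i < m} \<union>
               {{V i, V ((i + n) mod m)} | i. i < m} \<union>
               {{U i, V i} | i. i < m} \<rparr>"

lemma card_verts_generalized_petersen: "card (verts (generalized_petersen m n)) = 2 * m"
proof -
  have "card (U ` {..<m} \<union> V ` {..<m}) = card (U ` {..<m}) + card (V ` {..<m})"
    by (intro card_Un_disjoint) auto
  then show ?thesis
    by (simp add: generalized_petersen_def card_image inj_on_def)
qed

lemma simple_graph_generalized_petersen: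
  assumes "2 \<le> m" and "\<not> m dvd n"
  shows "simple_graph (generalized_petersen m n)"
proof -
  have shift: "i \<noteq> (i + d) mod m" if "i < m" "\<not> m dvd d" for i d :: nat
  proof
    assume "i = (i + d) mod m"
    then have "(i + d) mod m = i mod m" using that by simp
    then have "m dvd (i + d) - i" using mod_eq_dvd_iff_nat le_add1 by blast
    then show False using that by simp
  qed
  have "\<not> m dvd 1" using assms by auto
  note shift1 = shift[OF _ this] and shiftn = shift[OF _ assms(2)]
  show ?thesis
    using assms(1) shift1 shiftn
    by (auto simp: simple_graph_def generalized_petersen_def card_2_iff)
qed

end

theory Submission
  imports Defs "HOL-Number_Theory.Cong"
begin

text \<open>The inner edges of \<open>P(3n,n)\<close> form \<open>n\<close> triangles, and this decides both bounds.

  Lower bound. Four colors fail already near one triangle. Its edges take three colors. If a pendant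
  edge of the triangle repeated the color of the opposite triangle edge, then the two further
  edges at its outer end would both be forced to the fourth color
  (\<open>pendant_color_at_triangle\<close>); so all three pendant edges have the fourth color. But
  then the two further edges at the end of a pendant edge are again forced to one common color
  (\<open>triangle_needs_five_colors\<close>).

  Upper bound. Cut the graph into \<open>n\<close> columns, each consisting of a triangle, its three spokes
  and the three outer edges that leave it in one direction. The columns form a ring that is
  closed with a twist: passing \<open>n\<close> columns moves from one row to the next. A coloring is thus a word
  of \<open>n\<close> colored columns that is continued by its own rotated copy. As walks of length four are short,
  the word only has to satisfy a condition on every four consecutive columns
  (\<open>star_edge_coloring_of_word\<close>). Such words are assembled from a tile of length three, repeated
  arbitrarily often, followed by at most two tiles of length two, which accounts for the residue of
  \<open>n\<close> modulo three (\<open>word_of_tiles\<close>).\<close>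

section \<open>Star edge-colorings\<close>

lemma path_edges_simps [simp]:
  "path_edges [x] = {}"
  "path_edges (x # y # xs) = insert {x, y} (path_edges (y # xs))"
proof -
  show "path_edges [x] = {}"
    by (simp add: path_edges_def)
  show "path_edges (x # y # xs) = insert {x, y} (path_edges (y # xs))" (is "?l = ?r")
  proof (intro equalityI subsetI)
    fix e assume "e \<in> ?l"
    then obtain i where i: "e = {(x # y # xs) ! i, (x # y # xs) ! Suc i}" "Suc i < length (x # y # xs)"
      unfolding path_edges_def by blast
    then show "e \<in> ?r"
      by (cases i) (auto simp: path_edges_def)
  next
    fix e assume "e \<in> ?r"
    then consider "e = {x, y}"
      | i where "e = {(y # xs) ! i, (y # xs) ! Suc i}" "Suc i < length (y # xs)"
      unfolding path_edges_def by blast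
    then show "e \<in> ?l"
    proof cases
      case 1
      then show ?thesis unfolding path_edges_def by (auto intro!: exI[of _ 0])
    next
      case 2
      then show ?thesis unfolding path_edges_def by (auto intro!: exI[of _ "Suc i"])
    qed
  qed
qed

lemma is_path_simps [simp]:
  "is_path G [x] \<longleftrightarrow> x \<in> verts G"
  "is_path G (x # y # xs) \<longleftrightarrow>
     x \<in> verts G \<and> x \<notin> set (y # xs) \<and> {x, y} \<in> edges G \<and> is_path G (y # xs)"
proof -
  show "is_path G [x] \<longleftrightarrow> x \<in> verts G"
    by (simp add: is_path_def)
  have "(\<forall>i. Suc i < length (x # y # xs) \<longrightarrow>
          {(x # y # xs) ! i, (x # y # xs) ! Suc i} \<in> edges G) \<longleftrightarrow>
        {x, y} \<in> edges G \<and>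
        (\<forall>i. Suc i < length (y # xs) \<longrightarrow> {(y # xs) ! i, (y # xs) ! Suc i} \<in> edges G)"
    (is "?l \<longleftrightarrow> ?r")
  proof
    assume l: ?l
    show ?r
      using l[rule_format, of 0] l[rule_format, of "Suc i" for i] by simp
  next
    assume r: ?r
    show ?l
    proof (intro allI impI)
      fix i assume "Suc i < length (x # y # xs)"
      then show "{(x # y # xs) ! i, (x # y # xs) ! Suc i} \<in> edges G"
        using r by (cases i) auto
    qed
  qed
  then show "is_path G (x # y # xs) \<longleftrightarrow>
     x \<in> verts G \<and> x \<notin> set (y # xs) \<and> {x, y} \<in> edges G \<and> is_path G (y # xs)"
    unfolding is_path_def by auto
qed

text \<open>A walk of length four is judged from its midpoint \<open>v\<close>: each half is a first color followed by
  one of the colors available behind it. Two halves fit together when their first colors differ and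
  the four colors do not alternate.\<close>

definition arm :: "('a, 'b) graph_scheme \<Rightarrow> ('a set \<Rightarrow> 'c) \<Rightarrow> 'a \<Rightarrow> 'a \<Rightarrow> 'c \<times> 'c set" where
  "arm G c v x = (c {v, x}, {c {x, x'} | x'. {x, x'} \<in> edges G \<and> x' \<noteq> v})"

definition compatible :: "'c \<times> 'c set \<Rightarrow> 'c \<times> 'c set \<Rightarrow> bool" where
  "compatible P Q \<longleftrightarrow> fst P \<noteq> fst Q \<and> \<not> (fst Q \<in> snd P \<and> fst P \<in> snd Q)"

lemma compatible_sym: "compatible P Q \<Longrightarrow> compatible Q P"
  by (auto simp: compatible_def)

lemma three_le_card:
  assumes "w \<noteq> x" "x \<noteq> y" "y \<noteq> z" "\<not> (w = y \<and> x = z)"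
  shows "3 \<le> card {w, x, y, z}"
  using assms by (auto simp: card_insert_if)

text \<open>Paths and cycles of length four are both walks that never turn back at an inner vertex, and
  for such walks alternation of colors is visible at the midpoint. Hence one local condition on the
  neighbors of each vertex covers properness, paths and cycles, and no global distinctness of
  vertices has to be tracked.\<close>

lemma star_edge_coloringI:
  assumes "simple_graph G" and range: "c ` edges G \<subseteq> {..<k}"
    and arms: "\<And>v x y. {v, x} \<in> edges G \<Longrightarrow> {v, y} \<in> edges G \<Longrightarrow> x \<noteq> y \<Longrightarrow>
      compatible (arm G c v x) (arm G c v y)"
  shows "star_edge_coloring G k c"
proof -
  have diff: "c {v, x} \<noteq> c {v, y}" if "{v, x} \<in> edges G" "{v, y} \<in> edges G" "x \<noteq> y" for v x y
    using arms[OF that] by (simp add: compatible_def arm_def)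
  have proper: "proper_edge_coloring G c"
    unfolding proper_edge_coloring_def
  proof (intro ballI impI)
    fix e f assume ef: "e \<in> edges G" "f \<in> edges G" and "e \<noteq> f \<and> e \<inter> f \<noteq> {}"
    then obtain v where v: "v \<in> e" "v \<in> f" and "e \<noteq> f" by blast
    have "card e = 2" "card f = 2"
      using ef assms(1) by (auto simp: simple_graph_def)
    then obtain x y where "e = {v, x}" "f = {v, y}"
      using v by (metis card_2_iff doubleton_eq_iff insert_iff singletonD)
    then show "c e \<noteq> c f"
      using diff ef \<open>e \<noteq> f\<close> by blast
  qed
  have walk: "3 \<le> card {c {a, b}, c {b, v}, c {v, d}, c {d, e}}"
    if E: "{a, b} \<in> edges G" "{b, v} \<in> edges G" "{v, d} \<in> edges G" "{d, e} \<in> edges G"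
      and ne: "a \<noteq> v" "b \<noteq> d" "e \<noteq> v" for a b v d e
  proof (rule three_le_card)
    have sym: "{b, a} \<in> edges G" "{v, b} \<in> edges G" "{d, v} \<in> edges G"
      using E by (simp_all add: insert_commute)
    show "c {a, b} \<noteq> c {b, v}"
      using diff[OF sym(1) E(2)] ne by (simp add: insert_commute)
    show "c {b, v} \<noteq> c {v, d}"
      using diff[OF sym(2) E(3)] ne by (simp add: insert_commute)
    show "c {v, d} \<noteq> c {d, e}"
      using diff[OF sym(3) E(4)] ne by (simp add: insert_commute)
    have "compatible (arm G c v b) (arm G c v d)"
      using arms sym(2) E(3) ne by blast
    moreover have "c {b, a} \<in> snd (arm G c v b)" "c {d, e} \<in> snd (arm G c v d)"
      using sym(1) E(4) ne by (auto simp: arm_def)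
    ultimately show "\<not> (c {a, b} = c {v, d} \<and> c {b, v} = c {d, e})"
      by (auto simp: compatible_def arm_def insert_commute)
  qed
  have "3 \<le> card (c ` path_edges p)" if p: "is_path G p" "length p = 5" for p
  proof -
    obtain a b v d e where "p = [a, b, v, d, e]"
      using p(2) by (auto simp: numeral_eq_Suc length_Suc_conv)
    then show ?thesis
      using p(1) walk[of a b v d e] by auto
  qed
  moreover have "3 \<le> card (c ` cycle_edges p)" if p: "is_cycle G p" "length p = 4" for p
  proof -
    obtain b v d a where "p = [b, v, d, a]"
      using p(2) by (auto simp: numeral_eq_Suc length_Suc_conv)
    then show ?thesis
      using p(1) walk[of a b v d a] by (auto simp: is_cycle_def cycle_edges_def)
  qed
  ultimately show ?thesis
    using range proper by (simp add: star_edge_coloring_def)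
qed

section \<open>Four colors are not enough around a triangle\<close>

lemma star_edge_coloring_path4:
  assumes "star_edge_coloring G k c" "is_path G [v1, v2, v3, v4, v5]"
    and "c {v1, v2} = c {v3, v4}"
  shows "c {v2, v3} \<noteq> c {v4, v5}"
proof
  assume "c {v2, v3} = c {v4, v5}"
  then have "card (c ` path_edges [v1, v2, v3, v4, v5]) \<le> 2"
    using assms(3) by (simp add: card_insert_if)
  moreover have "3 \<le> card (c ` path_edges [v1, v2, v3, v4, v5])"
    using assms(1,2) by (auto simp: star_edge_coloring_def simp del: is_path_simps path_edges_simps)
  ultimately show False by simp
qed

lemma star_edge_coloring_adjacent:
  assumes "star_edge_coloring G k c" "{v, x} \<in> edges G" "{v, y} \<in> edges G" "x \<noteq> y"
  shows "c {v, x} \<noteq> c {v, y}"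
  using assms by (auto simp: star_edge_coloring_def proper_edge_coloring_def doubleton_eq_iff)

lemma five_distinct_colors:
  assumes "distinct [a, b, d, e, f]" "{a, b, d, e, f} \<subseteq> {..<k :: nat}"
  shows "5 \<le> k"
  using card_mono[OF _ assms(2)] assms(1) by simp

text \<open>Let \<open>p\<close> be the outer end of the pendant edge at \<open>x\<close> and \<open>w\<close> a further neighbor of \<open>p\<close>. If
  the pendant edge has the color of \<open>{y, z}\<close>, the paths \<open>w p x y z\<close> and \<open>w p x z y\<close>
  forbid the other two triangle colors on \<open>{p, w}\<close>. Both choices of \<open>w\<close> therefore need
  colors outside the triangle, and different ones.\<close>

lemma pendant_color_at_triangle:
  assumes "simple_graph G" and star: "star_edge_coloring G k c"
    and E: "{x, y} \<in> edges G" "{x, z} \<in> edges G" "{y, z} \<in> edges G"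
      "{x, p} \<in> edges G" "{p, s} \<in> edges G" "{p, t} \<in> edges G"
    and ne: "distinct [x, y, z, p, s, t]"
    and eq: "c {x, p} = c {y, z}"
  shows "5 \<le> k"
proof -
  have V: "set [x, y, z, p, s, t] \<subseteq> verts G"
    using assms(1) E by (auto simp: simple_graph_def)
  note adj = star_edge_coloring_adjacent[OF star]
  have sym: "{y, x} \<in> edges G" "{z, x} \<in> edges G" "{z, y} \<in> edges G" "{p, x} \<in> edges G"
    "{s, p} \<in> edges G" "{t, p} \<in> edges G"
    using E by (simp_all add: insert_commute)
  have other: "c {p, w} \<noteq> c {x, y} \<and> c {p, w} \<noteq> c {x, z} \<and> c {p, w} \<noteq> c {y, z}"
    if w: "w \<in> {s, t}" for w
  proof (intro conjI notI)
    have wp: "{w, p} \<in> edges G" "{p, w} \<in> edges G" using w E sym by auto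
    have "is_path G [w, p, x, y, z]" "is_path G [w, p, x, z, y]"
      using w E sym ne V by auto
    note path = this[THEN star_edge_coloring_path4[OF star]]
    show False if "c {p, w} = c {x, y}"
      using path(1) that eq by (simp add: insert_commute)
    show False if "c {p, w} = c {x, z}"
      using path(2) that eq by (simp add: insert_commute)
    show False if "c {p, w} = c {y, z}"
      using adj[OF sym(4) wp(2)] that eq w ne by (auto simp: insert_commute)
  qed
  have "distinct [c {x, y}, c {x, z}, c {y, z}, c {p, s}, c {p, t}]"
    using other[of s] other[of t] adj[OF E(1,2)] adj[OF sym(1) E(3)] adj[OF sym(2,3)]
      adj[OF E(5,6)] ne by (auto simp: insert_commute)
  moreover have "{c {x, y}, c {x, z}, c {y, z}, c {p, s}, c {p, t}} \<subseteq> {..<k}"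
    using star E by (auto simp: star_edge_coloring_def)
  ultimately show ?thesis by (rule five_distinct_colors)
qed

text \<open>With four colors, all pendant edges share the color missing on the triangle. A further edge at
  \<open>y'\<close> then avoids this color, and it avoids the colors of both triangle edges at \<open>y\<close>, because each
  of these lies between two pendant edges. Only the color of \<open>{x, z}\<close> is left for two edges.\<close>

lemma triangle_needs_five_colors:
  assumes simple: "simple_graph G" and star: "star_edge_coloring G k c"
    and E: "{x, y} \<in> edges G" "{x, z} \<in> edges G" "{y, z} \<in> edges G"
      "{x, x'} \<in> edges G" "{y, y'} \<in> edges G" "{z, z'} \<in> edges G"
    and ne: "distinct [x, y, z, x', y', z']"
    and cubic: "\<And>p. p \<in> {x', y', z'} \<Longrightarrow> \<exists>s t. s \<noteq> t \<and> {p, s} \<in> edges G \<and> {p, t} \<in> edges G \<and>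
      s \<notin> {x, y, z, x', y', z'} \<and> t \<notin> {x, y, z, x', y', z'}"
  shows "5 \<le> k"
proof (rule ccontr)
  assume "\<not> 5 \<le> k"
  note pendant = pendant_color_at_triangle[OF simple star]
  note adj = star_edge_coloring_adjacent[OF star]
  have sym: "{y, x} \<in> edges G" "{z, x} \<in> edges G" "{z, y} \<in> edges G"
    using E by (simp_all add: insert_commute)
  obtain s1 t1 where 1: "s1 \<noteq> t1" "{x', s1} \<in> edges G" "{x', t1} \<in> edges G"
      "s1 \<notin> {x, y, z, x', y', z'}" "t1 \<notin> {x, y, z, x', y', z'}"
    using cubic[of x'] by auto
  obtain s2 t2 where 2: "s2 \<noteq> t2" "{y', s2} \<in> edges G" "{y', t2} \<in> edges G"
      "s2 \<notin> {x, y, z, x', y', z'}" "t2 \<notin> {x, y, z, x', y', z'}"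
    using cubic[of y'] by auto
  obtain s3 t3 where 3: "s3 \<noteq> t3" "{z', s3} \<in> edges G" "{z', t3} \<in> edges G"
      "s3 \<notin> {x, y, z, x', y', z'}" "t3 \<notin> {x, y, z, x', y', z'}"
    using cubic[of z'] by auto
  have opp: "c {x, x'} \<noteq> c {y, z}" "c {y, y'} \<noteq> c {x, z}" "c {z, z'} \<noteq> c {x, y}"
    using pendant[OF E(1,2,3,4) 1(2,3)] pendant[OF sym(1) E(3,2,5) 2(2,3)]
      pendant[OF sym(2,3) E(1,6) 3(2,3)] 1 2 3 ne \<open>\<not> 5 \<le> k\<close> by auto
  have tri: "c {x, y} \<noteq> c {x, z}" "c {x, y} \<noteq> c {y, z}" "c {x, z} \<noteq> c {y, z}"
    using adj[OF E(1,2)] adj[OF sym(1) E(3)] adj[OF sym(2,3)] ne by (auto simp: insert_commute)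
  have next': "c {x, x'} \<noteq> c {x, y}" "c {x, x'} \<noteq> c {x, z}" "c {y, y'} \<noteq> c {x, y}"
      "c {y, y'} \<noteq> c {y, z}" "c {z, z'} \<noteq> c {x, z}" "c {z, z'} \<noteq> c {y, z}"
    using adj[OF E(4,1)] adj[OF E(4,2)] adj[OF E(5) sym(1)] adj[OF E(5,3)] adj[OF E(6) sym(2)]
      adj[OF E(6) sym(3)] ne by (auto simp: insert_commute)
  have colors: "c {x, y} < k" "c {x, z} < k" "c {y, z} < k" "c {x, x'} < k" "c {y, y'} < k" "c {z, z'} < k"
      "c {y', s2} < k" "c {y', t2} < k"
    using star E 2 by (auto simp: star_edge_coloring_def)
  \<comment> \<open>All three pendant edges have the one color that is missing on the triangle.\<close>
  have same: "c {y, y'} = c {x, x'}" "c {y, y'} = c {z, z'}"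
    using five_distinct_colors[of "c {x, y}" "c {x, z}" "c {y, z}" "c {y, y'}" "c {x, x'}" k]
      five_distinct_colors[of "c {x, y}" "c {x, z}" "c {y, z}" "c {y, y'}" "c {z, z'}" k]
      opp tri next' colors \<open>\<not> 5 \<le> k\<close> by auto
  have V: "{x, y, z, x', y', z', s2, t2} \<subseteq> verts G"
    using simple E 2 by (auto simp: simple_graph_def)
  have only: "c {y', w} \<noteq> c {x, y} \<and> c {y', w} \<noteq> c {y, z} \<and> c {y', w} \<noteq> c {y, y'}"
    if w: "w \<in> {s2, t2}" for w
  proof (intro conjI notI)
    have wE: "{w, y'} \<in> edges G" "{y', w} \<in> edges G" "{y', y} \<in> edges G"
      using w 2 E by (auto simp: insert_commute)
    have "is_path G [w, y', y, x, x']" "is_path G [w, y', y, z, z']"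
      using w wE E sym ne V 2 by auto
    note path = this[THEN star_edge_coloring_path4[OF star]]
    show False if "c {y', w} = c {x, y}"
      using path(1) that same by (simp add: insert_commute)
    show False if "c {y', w} = c {y, z}"
      using path(2) that same by (simp add: insert_commute)
    show False if "c {y', w} = c {y, y'}"
      using adj[OF wE(2,3)] that w 2 by (auto simp: insert_commute)
  qed
  have "c {y', s2} \<noteq> c {y', t2}"
    using adj[OF 2(2,3,1)] .
  then have "distinct [c {x, y}, c {y, z}, c {y, y'}, c {y', s2}, c {y', t2}]"
    using only[of s2] only[of t2] tri next' by auto
  then have "5 \<le> k"
    by (rule five_distinct_colors) (use colors in auto)
  then show False using \<open>\<not> 5 \<le> k\<close> by simp
qed

lemma generalized_petersen_needs_five_colors:
  assumes "n \<ge> 2" "star_edge_coloring (generalized_petersen (3 * n) n) k c"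
  shows "5 \<le> k"
proof (rule triangle_needs_five_colors[OF _ assms(2)])
  let ?G = "generalized_petersen (3 * n) n"
  show "simple_graph ?G"
    using assms(1) by (intro simple_graph_generalized_petersen) (auto dest: dvd_imp_le)
  have out: "{U i, U ((i + 1) mod (3 * n))} \<in> edges ?G"
    and inn: "{V i, V ((i + n) mod (3 * n))} \<in> edges ?G"
    and spoke: "{V i, U i} \<in> edges ?G" if "i < 3 * n" for i
    using that by (auto simp: generalized_petersen_def insert_commute)
  have mods: "(0 + n) mod (3 * n) = n" "(n + n) mod (3 * n) = 2 * n" "(2 * n + n) mod (3 * n) = 0"
    using assms(1) by (simp_all del: mult_2 add: mult_2[symmetric])
  have small: "0 < 3 * n" "n < 3 * n" "2 * n < 3 * n"
    using assms(1) by simp_all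
  show "{V 0, V n} \<in> edges ?G" "{V 0, V (2 * n)} \<in> edges ?G" "{V n, V (2 * n)} \<in> edges ?G"
    using inn[OF small(1)] inn[OF small(2)] inn[OF small(3)]
    unfolding mods by (simp_all only: insert_commute)
  show "{V 0, U 0} \<in> edges ?G" "{V n, U n} \<in> edges ?G" "{V (2 * n), U (2 * n)} \<in> edges ?G"
    using spoke assms(1) by auto
  show "distinct [V 0, V n, V (2 * n), U 0, U n, U (2 * n)]"
    using assms(1) by auto
  fix p assume "p \<in> {U 0, U n, U (2 * n)}"
  then consider "p = U 0" | i where "p = U i" "i = n \<or> i = 2 * n" by auto
  then show "\<exists>s t. s \<noteq> t \<and> {p, s} \<in> edges ?G \<and> {p, t} \<in> edges ?G \<and>
      s \<notin> {V 0, V n, V (2 * n), U 0, U n, U (2 * n)} \<and> t \<notin> {V 0, V n, V (2 * n), U 0, U n, U (2 * n)}"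
  proof cases
    case 1
    then show ?thesis
      using out[of 0] out[of "3 * n - 1"] assms(1)
      by (intro exI[of _ "U 1"] exI[of _ "U (3 * n - 1)"]) (auto simp: insert_commute)
  next
    case 2
    then show ?thesis
      using out[of i] out[of "i - 1"] assms(1)
      by (intro exI[of _ "U (i + 1)"] exI[of _ "U (i - 1)"]) (auto simp: insert_commute)
  qed
qed

section \<open>Colorings given by columns\<close>

text \<open>The colors of the outer edges leaving the column, of the spokes and of the inner triangle, each
  listed by row; the triangle edge of row \<open>r\<close> leads from row \<open>r\<close> to row \<open>r + 1\<close> modulo 3. In
  column \<open>i\<close>, row \<open>r\<close> belongs to the subscript \<open>i + r n\<close>.\<close>

type_synonym column = "(nat \<times> nat \<times> nat) \<times> (nat \<times> nat \<times> nat) \<times> (nat \<times> nat \<times> nat)"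

definition outer :: "column \<Rightarrow> nat" where "outer C = fst (fst C)"
definition spoke :: "column \<Rightarrow> nat" where "spoke C = fst (fst (snd C))"
definition inner :: "column \<Rightarrow> nat" where "inner C = fst (snd (snd C))"

text \<open>Rotation renumbers the rows so that row one comes first. Hence the entries of row \<open>r\<close>
  are read off as the first entries after \<open>r\<close> rotations.\<close>

fun rot :: "column \<Rightarrow> column" where
  "rot ((a, b, c), (d, e, f), (g, h, i)) = ((b, c, a), (e, f, d), (h, i, g))"

lemma rot_rot_rot [simp]: "rot (rot (rot C)) = C"
  by (cases C rule: rot.cases) simp

text \<open>Compatibility of the arms at the two vertices of row zero of column \<open>C2\<close>: the first list is
  for the outer vertex, the second one for the inner vertex. Two columns are needed before \<open>C2\<close> but
  only one after it, since an outer edge is stored with its left end. The inner edge from row two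
  back to row zero is stored with row two, hence \<open>rot (rot C2)\<close>.\<close>

definition row_ok :: "column \<Rightarrow> column \<Rightarrow> column \<Rightarrow> column \<Rightarrow> bool" where
  "row_ok C0 C1 C2 C3 \<longleftrightarrow>
     sorted_wrt compatible
       [(outer C1, {outer C0, spoke C1}),
        (outer C2, {outer C3, spoke C3}),
        (spoke C2, {inner C2, inner (rot (rot C2))})] \<and>
     sorted_wrt compatible
       [(spoke C2, {outer C1, outer C2}),
        (inner C2, {inner (rot C2), spoke (rot C2)}),
        (inner (rot (rot C2)), {inner (rot C2), spoke (rot (rot C2))})]"

definition window_ok :: "column \<Rightarrow> column \<Rightarrow> column \<Rightarrow> column \<Rightarrow> bool" where
  "window_ok C0 C1 C2 C3 \<longleftrightarrow>
     row_ok C0 C1 C2 C3 \<and> row_ok (rot C0) (rot C1) (rot C2) (rot C3) \<and>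
     row_ok (rot (rot C0)) (rot (rot C1)) (rot (rot C2)) (rot (rot C3))"

definition palette_ok :: "column \<Rightarrow> bool" where
  "palette_ok C \<longleftrightarrow> (\<forall>D \<in> {C, rot C, rot (rot C)}. {outer D, spoke D, inner D} \<subseteq> {..<5})"

fun windows_ok :: "column list \<Rightarrow> bool" where
  "windows_ok (C0 # C1 # C2 # C3 # xs) \<longleftrightarrow>
     window_ok C0 C1 C2 C3 \<and> windows_ok (C1 # C2 # C3 # xs)"
| "windows_ok _ \<longleftrightarrow> True"

lemma windows_ok_nth:
  "windows_ok xs \<Longrightarrow> i + 3 < length xs \<Longrightarrow>
     window_ok (xs ! i) (xs ! (i + 1)) (xs ! (i + 2)) (xs ! (i + 3))"
proof (induction xs arbitrary: i rule: windows_ok.induct)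
  case (1 C0 C1 C2 C3 xs)
  then show ?case by (cases i) (auto simp: eval_nat_numeral)
qed auto

lemma row_ok_twisted:
  assumes "window_ok C0 C1 C2 C3"
  shows "row_ok ((rot ^^ k) C0) ((rot ^^ k) C1) ((rot ^^ k) C2) ((rot ^^ k) C3)"
proof -
  have "window_ok ((rot ^^ k) C0) ((rot ^^ k) C1) ((rot ^^ k) C2) ((rot ^^ k) C3)"
    by (induction k) (use assms in \<open>auto simp: window_ok_def\<close>)
  then show ?thesis by (simp add: window_ok_def)
qed

context
  fixes n :: nat
  assumes n: "n \<ge> 2"
begin

abbreviation (input) G where "G \<equiv> generalized_petersen (3 * n) n"

text \<open>Subscripts range over all natural numbers and are reduced in these two functions, so that
  statements about neighbors contain no modulus.\<close>

definition u where "u i = U (i mod (3 * n))"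
definition v where "v i = V (i mod (3 * n))"

lemma u_ne_v [simp]: "u i \<noteq> v j" "v j \<noteq> u i"
  by (simp_all add: u_def v_def)

lemma v_eq_iff [simp]: "v i = v j \<longleftrightarrow> u i = u j"
  by (simp add: u_def v_def)

lemma u_shift [simp]: "u (i + d) = u (j + d) \<longleftrightarrow> u i = u j"
  using cong_add_rcancel_nat[of i d j "3 * n"] by (simp add: cong_def u_def)

lemma u_Suc [simp]: "u (Suc i) = u (Suc j) \<longleftrightarrow> u i = u j"
  using u_shift[of i 1 j] by simp

lemma u_period: "u (i + 3 * n) = u i"
  by (simp add: u_def)

lemma u_shift_ne:
  assumes "0 < d" "d < 3 * n"
  shows "u (i + d) \<noteq> u i"
  using u_shift[of d i 0] assms by (simp add: add.commute u_def)

lemma edges_G: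
  "edges G = {{u i, u (i + 1)} | i. True} \<union> {{v i, v (i + n)} | i. True} \<union> {{u i, v i} | i. True}"
proof -
  have residues: "{Q i | i. i < 3 * n} = {P i | i. True}"
    if "\<And>i. i < 3 * n \<Longrightarrow> Q i = P i" and "\<And>i. P (i mod (3 * n)) = P i"
    for P Q :: "nat \<Rightarrow> petersen_vertex set"
  proof (intro equalityI subsetI)
    fix e assume "e \<in> {P i | i. True}"
    then obtain i where "e = P i" by blast
    moreover have "i mod (3 * n) < 3 * n" using n by simp
    ultimately have "e = Q (i mod (3 * n))" using that by simp
    then show "e \<in> {Q i | i. i < 3 * n}" using \<open>i mod (3 * n) < 3 * n\<close> by blast
  qed (use that(1) in blast)
  show ?thesis
    unfolding generalized_petersen_def graph.simps
    by (intro arg_cong2[where f = "(\<union>)"] residues)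
      (simp_all only: u_def v_def mod_mod_trivial mod_add_left_eq mod_less)
qed

text \<open>Every subscript can be written as \<open>i + 2\<close>, so that windows of four columns, which start two
  columns to the left of their center, never need subtraction.\<close>

lemma vertex_cases:
  assumes "x \<in> verts G"
  obtains i where "x = u (i + 2)" | i where "x = v (i + 2)"
proof -
  from assms obtain j where j: "j < 3 * n" "x = U j \<or> x = V j"
    by (auto simp: generalized_petersen_def)
  have "(j + 3 * n - 2) + 2 = j + 3 * n" using n by simp
  then have "((j + 3 * n - 2) + 2) mod (3 * n) = j" using j(1) by simp
  then show thesis using j(2) that unfolding u_def v_def by metis
qed

lemma neighbor_u:
  assumes "{u (i + 1), y} \<in> edges G"
  shows "y = u i \<or> y = u (i + 2) \<or> y = v (i + 1)"
proof -
  consider j where "{u (i + 1), y} = {u j, u (j + 1)}" | j where "{u (i + 1), y} = {v j, v (j + n)}"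
    | j where "{u (i + 1), y} = {u j, v j}"
    using assms unfolding edges_G by blast
  then show ?thesis
  proof cases
    case (1 j)
    then consider "u (i + 1) = u j" "y = u (j + 1)" | "u (i + 1) = u (j + 1)" "y = u j"
      by (auto simp: doubleton_eq_iff)
    then show ?thesis
      using u_shift[of "i + 1" 1 j] u_shift[of i 1 j] by cases (simp_all add: numeral_2_eq_2)
  qed (auto simp: doubleton_eq_iff)
qed

lemma neighbor_v:
  assumes "{v i, y} \<in> edges G"
  shows "y = v (i + n) \<or> y = v (i + 2 * n) \<or> y = u i"
proof -
  consider j where "{v i, y} = {u j, u (j + 1)}" | j where "{v i, y} = {v j, v (j + n)}"
    | j where "{v i, y} = {u j, v j}"
    using assms unfolding edges_G by blast
  then show ?thesis
  proof cases
    case (2 j)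
    then consider "v i = v j" "y = v (j + n)" | "v i = v (j + n)" "y = v j"
      by (auto simp: doubleton_eq_iff)
    then show ?thesis
    proof cases
      case 1
      then show ?thesis by simp
    next
      case 2
      have "u (i + 2 * n) = u (j + n + 2 * n)"
        using 2(1) by (simp only: u_shift v_eq_iff)
      also have "j + n + 2 * n = j + 3 * n" by simp
      also have "u (j + 3 * n) = u j" by (rule u_period)
      finally show ?thesis using 2(2) by simp
    qed
  qed (auto simp: doubleton_eq_iff)
qed

text \<open>An edge determines the subscript by which it is listed: reading it backwards would make a shift by \<open>2\<close> or
  \<open>2 n\<close> trivial modulo \<open>3 n\<close>.\<close>

lemma edge_eq_iff:
  "{u i, u (i + 1)} = {u j, u (j + 1)} \<longleftrightarrow> u i = u j"
  "{v i, v (i + n)} = {v j, v (j + n)} \<longleftrightarrow> u i = u j"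
  "{u i, v i} = {u j, v j} \<longleftrightarrow> u i = u j"
proof -
  have "u i \<noteq> u (j + d) \<or> u (i + d) \<noteq> u j" if "0 < d" "2 * d < 3 * n" for d
  proof (rule ccontr)
    assume "\<not> ?thesis"
    then have "u (j + d + d) = u j" using u_shift[of i d "j + d"] by simp
    moreover have "j + d + d = j + 2 * d" by simp
    ultimately show False using u_shift_ne[of "2 * d" j] that by simp
  qed
  from this[of 1] this[of n]
  have 1: "u i \<noteq> u (j + 1) \<or> u (i + 1) \<noteq> u j" and 2: "u i \<noteq> u (j + n) \<or> u (i + n) \<noteq> u j"
    using n by simp_all
  show "{u i, u (i + 1)} = {u j, u (j + 1)} \<longleftrightarrow> u i = u j"
    unfolding doubleton_eq_iff u_shift using 1 by blast
  show "{v i, v (i + n)} = {v j, v (j + n)} \<longleftrightarrow> u i = u j"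
    unfolding doubleton_eq_iff v_eq_iff u_shift using 2 by blast
  show "{u i, v i} = {u j, v j} \<longleftrightarrow> u i = u j"
    unfolding doubleton_eq_iff v_eq_iff using u_ne_v by blast
qed

lemma edge_ne:
  "{u i, u k} \<noteq> {v j, v l}" "{v j, v l} \<noteq> {u i, u k}" "{u i, u k} \<noteq> {u j, v l}"
  "{u j, v l} \<noteq> {u i, u k}" "{v i, v k} \<noteq> {u j, v l}" "{u j, v l} \<noteq> {v i, v k}"
  unfolding doubleton_eq_iff using u_ne_v by blast+

text \<open>A sequence \<open>C\<close> of columns that is twisted in this way describes one color for every edge, since
  three rotations cancel and \<open>C\<close> has period \<open>3 n\<close>.\<close>

context
  fixes C :: "nat \<Rightarrow> column"
  assumes twist: "C (i + n) = rot (C i)"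
begin

definition col_coloring :: "petersen_vertex set \<Rightarrow> nat" where
  "col_coloring e = (THE k.
     (\<exists>i. e = {u i, u (i + 1)} \<and> k = outer (C i)) \<or>
     (\<exists>i. e = {v i, v (i + n)} \<and> k = inner (C i)) \<or>
     (\<exists>i. e = {u i, v i} \<and> k = spoke (C i)))"

lemma C_cong: "u i = u j \<Longrightarrow> C i = C j"
proof -
  have period: "C (i + 3 * n) = C i" for i
  proof -
    have "i + 3 * n = i + n + n + n" by simp
    then show ?thesis by (simp only: twist rot_rot_rot)
  qed
  have multiple: "C (i + k * (3 * n)) = C i" for i k
  proof (induction k)
    case (Suc k)
    have "i + Suc k * (3 * n) = i + k * (3 * n) + 3 * n" by simp
    then show ?case using Suc by (simp only: period)
  qed simp
  have reduce: "C i = C (i mod (3 * n))" for i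
    using multiple[of "i mod (3 * n)" "i div (3 * n)"] by (simp only: mod_div_mult_eq)
  show "u i = u j \<Longrightarrow> C i = C j"
    using reduce[of i] reduce[of j] by (simp add: u_def)
qed

lemma col_coloring_edges:
  "col_coloring {u i, u (i + 1)} = outer (C i)"
  "col_coloring {v i, v (i + n)} = inner (C i)"
  "col_coloring {u i, v i} = spoke (C i)"
proof -
  have eqI: "(THE k. (\<exists>j. u i = u j \<and> k = P (C j))) = P (C i)" for P :: "column \<Rightarrow> nat"
    by (rule the_equality) (blast, metis C_cong)
  show "col_coloring {u i, u (i + 1)} = outer (C i)"
    "col_coloring {v i, v (i + n)} = inner (C i)"
    "col_coloring {u i, v i} = spoke (C i)"
    unfolding col_coloring_def
    by (simp_all only: edge_eq_iff edge_ne simp_thms ex_simps eqI)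
qed

text \<open>Since \<open>C\<close> is twisted, the entries in rows one and two of column \<open>i\<close> are the entries
  in row zero of columns \<open>i + n\<close> and \<open>i + 2 n\<close>. So it suffices to inspect row zero
  at every \<open>i\<close>, where the arms are exactly those that \<open>row_ok\<close> compares.\<close>

lemma star_edge_coloring_of_columns:
  assumes ok: "\<And>i. row_ok (C i) (C (i + 1)) (C (i + 2)) (C (i + 3))"
    and palette: "\<And>i. {outer (C i), spoke (C i), inner (C i)} \<subseteq> {..<5}"
  shows "star_edge_coloring G 5 col_coloring"
proof (rule star_edge_coloringI)
  note colors = col_coloring_edges
  show simple: "simple_graph G"
    using n by (intro simple_graph_generalized_petersen) (auto dest: dvd_imp_le)
  show "col_coloring ` edges G \<subseteq> {..<5}"
    using palette unfolding edges_G by (auto simp: colors simp del: One_nat_def add_Suc_right)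
  have twist2: "C (i + 2 * n) = rot (rot (C i))" for i
    using twist[of i] twist[of "i + n"] by (simp add: mult_2 add.assoc)
  have around: "v (i + 2 * n + n) = v i" "v (i + n + 2 * n) = v i" "v (i + 2 * n + 2 * n) = v (i + n)" for i
  proof -
    have "i + 2 * n + n = i + 3 * n" "i + n + 2 * n = i + 3 * n" "i + 2 * n + 2 * n = (i + n) + 3 * n"
      by simp_all
    then show "v (i + 2 * n + n) = v i" "v (i + n + 2 * n) = v i" "v (i + 2 * n + 2 * n) = v (i + n)"
      by (simp_all only: v_eq_iff u_period)
  qed
  \<comment> \<open>The six kinds of arms; the subscript of the center is \<open>i + 2\<close> where outer edges matter.\<close>
  define A where "A = arm G col_coloring"
  have bounds: "fst (A w x) = p \<and> snd (A w x) \<subseteq> P"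
    if "col_coloring {w, x} = p" "\<And>y. {x, y} \<in> edges G \<Longrightarrow> y \<noteq> w \<Longrightarrow> col_coloring {x, y} \<in> P"
    for w x p P
    using that by (auto simp: A_def arm_def)
  have colors': "col_coloring {u (i + 1), u i} = outer (C i)"
      "col_coloring {v (i + n), v i} = inner (C i)" "col_coloring {v i, u i} = spoke (C i)" for i
    using colors[of i] by (simp_all only: insert_commute)
  have wrap: "col_coloring {v i, v (i + 2 * n)} = inner (rot (rot (C i)))"
      "col_coloring {v (i + 2 * n), v i} = inner (rot (rot (C i)))" for i
    using colors(2)[of "i + 2 * n"] colors'(2)[of "i + 2 * n"] by (simp_all only: around twist2)
  have eqs: "i + 1 + 1 = i + 2" "i + 2 + 1 = i + 3" "i + 1 + 2 = i + 3" "i + 2 + 2 = i + 3 + 1"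
    "i + n + n = i + 2 * n" for i
    by simp_all
  have left: "fst (A (u (i + 2)) (u (i + 1))) = outer (C (i + 1)) \<and>
      snd (A (u (i + 2)) (u (i + 1))) \<subseteq> {outer (C i), spoke (C (i + 1))}" for i
  proof (rule bounds)
    show "col_coloring {u (i + 2), u (i + 1)} = outer (C (i + 1))"
      using colors'(1)[of "i + 1"] unfolding eqs .
    show "col_coloring {u (i + 1), y} \<in> {outer (C i), spoke (C (i + 1))}"
      if "{u (i + 1), y} \<in> edges G" "y \<noteq> u (i + 2)" for y
      using neighbor_u[OF that(1)] that(2) colors'(1)[of i] colors(3)[of "i + 1"] by auto
  qed
  have right: "fst (A (u (i + 2)) (u (i + 3))) = outer (C (i + 2)) \<and>
      snd (A (u (i + 2)) (u (i + 3))) \<subseteq> {outer (C (i + 3)), spoke (C (i + 3))}" for i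
  proof (rule bounds)
    show "col_coloring {u (i + 2), u (i + 3)} = outer (C (i + 2))"
      using colors(1)[of "i + 2"] unfolding eqs .
    show "col_coloring {u (i + 3), y} \<in> {outer (C (i + 3)), spoke (C (i + 3))}"
      if "{u (i + 3), y} \<in> edges G" "y \<noteq> u (i + 2)" for y
      using neighbor_u[of "i + 2" y] that colors(1)[of "i + 3"] colors(3)[of "i + 3"]
      unfolding eqs by auto
  qed
  have down: "fst (A (u i) (v i)) = spoke (C i) \<and>
      snd (A (u i) (v i)) \<subseteq> {inner (C i), inner (rot (rot (C i)))}" for i
  proof (rule bounds)
    show "col_coloring {v i, y} \<in> {inner (C i), inner (rot (rot (C i)))}"
      if "{v i, y} \<in> edges G" "y \<noteq> u i" for y
      using neighbor_v[OF that(1)] that(2) colors(2)[of i] wrap(1)[of i] by auto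
  qed (rule colors)
  have up: "fst (A (v (i + 2)) (u (i + 2))) = spoke (C (i + 2)) \<and>
      snd (A (v (i + 2)) (u (i + 2))) \<subseteq> {outer (C (i + 1)), outer (C (i + 2))}" for i
  proof (rule bounds)
    show "col_coloring {u (i + 2), y} \<in> {outer (C (i + 1)), outer (C (i + 2))}"
      if "{u (i + 2), y} \<in> edges G" "y \<noteq> v (i + 2)" for y
      using neighbor_u[of "i + 1" y] that colors'(1)[of "i + 1"] colors(1)[of "i + 2"]
      unfolding eqs by auto
  qed (rule colors')
  have ahead: "fst (A (v i) (v (i + n))) = inner (C i) \<and>
      snd (A (v i) (v (i + n))) \<subseteq> {inner (rot (C i)), spoke (rot (C i))}" for i
  proof (rule bounds)
    show "col_coloring {v (i + n), y} \<in> {inner (rot (C i)), spoke (rot (C i))}"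
      if "{v (i + n), y} \<in> edges G" "y \<noteq> v i" for y
      using neighbor_v[OF that(1)] that(2) colors(2)[of "i + n"] colors'(3)[of "i + n"]
      unfolding twist around by auto
  qed (rule colors)
  have behind: "fst (A (v i) (v (i + 2 * n))) = inner (rot (rot (C i))) \<and>
      snd (A (v i) (v (i + 2 * n))) \<subseteq> {inner (rot (C i)), spoke (rot (rot (C i)))}" for i
  proof (rule bounds)
    show "col_coloring {v (i + 2 * n), y} \<in> {inner (rot (C i)), spoke (rot (rot (C i)))}"
      if "{v (i + 2 * n), y} \<in> edges G" "y \<noteq> v i" for y
      using neighbor_v[OF that(1)] that(2) colors'(2)[of "i + n"] colors'(3)[of "i + 2 * n"]
      unfolding twist twist2 around eqs by auto
  qed (rule wrap)
  have mono: "compatible X Y" if "compatible (p, P) (q, Q)" "fst X = p \<and> snd X \<subseteq> P"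
    "fst Y = q \<and> snd Y \<subseteq> Q" for X Y p P q Q
    using that by (auto simp: compatible_def)
  show "compatible (arm G col_coloring w x) (arm G col_coloring w y)"
    if E: "{w, x} \<in> edges G" "{w, y} \<in> edges G" "x \<noteq> y" for w x y
  proof -
    have "w \<in> verts G"
      using simple E by (auto simp: simple_graph_def)
    then show ?thesis
    proof (cases rule: vertex_cases)
      case (1 i)
      have "x = u (i + 1) \<or> x = u (i + 3) \<or> x = v (i + 2)"
          "y = u (i + 1) \<or> y = u (i + 3) \<or> y = v (i + 2)"
        using neighbor_u[of "i + 1"] E unfolding eqs 1 by blast+
      moreover have "compatible (A w (u (i + 1))) (A w (u (i + 3)))"
        unfolding 1
        by (rule mono[OF _ left right]) (use ok[of i] in \<open>simp add: row_ok_def\<close>)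
      moreover have "compatible (A w (u (i + 1))) (A w (v (i + 2)))"
        unfolding 1
        by (rule mono[OF _ left down]) (use ok[of i] in \<open>simp add: row_ok_def\<close>)
      moreover have "compatible (A w (u (i + 3))) (A w (v (i + 2)))"
        unfolding 1
        by (rule mono[OF _ right down]) (use ok[of i] in \<open>simp add: row_ok_def\<close>)
      ultimately show ?thesis
        using E(3) compatible_sym unfolding A_def by blast
    next
      case (2 i)
      have "x = v (i + 2 + n) \<or> x = v (i + 2 + 2 * n) \<or> x = u (i + 2)"
          "y = v (i + 2 + n) \<or> y = v (i + 2 + 2 * n) \<or> y = u (i + 2)"
        using neighbor_v[of "i + 2"] E unfolding 2 by blast+
      moreover have "compatible (A w (u (i + 2))) (A w (v (i + 2 + n)))"
        unfolding 2
        by (rule mono[OF _ up ahead]) (use ok[of i] in \<open>simp add: row_ok_def\<close>)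
      moreover have "compatible (A w (u (i + 2))) (A w (v (i + 2 + 2 * n)))"
        unfolding 2
        by (rule mono[OF _ up behind]) (use ok[of i] in \<open>simp add: row_ok_def\<close>)
      moreover have "compatible (A w (v (i + 2 + n))) (A w (v (i + 2 + 2 * n)))"
        unfolding 2
        by (rule mono[OF _ ahead behind]) (use ok[of i] in \<open>simp add: row_ok_def\<close>)
      ultimately show ?thesis
        using E(3) compatible_sym unfolding A_def by blast
    qed
  qed
qed

end

text \<open>A window that starts in \<open>w\<close> reaches at most three columns beyond its end; for \<open>n = 2\<close> this
  extends into the second rotated copy. All other windows are rotations of these.\<close>

lemma star_edge_coloring_of_word:
  assumes len: "length w = n"
    and ok: "windows_ok (w @ take 3 (map rot w @ map (rot \<circ> rot) w))"
    and palette: "\<forall>C \<in> set w. palette_ok C"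
  shows "\<exists>c. star_edge_coloring G 5 c"
proof -
  define C where "C i = (rot ^^ (i div n)) (w ! (i mod n))" for i
  have n0: "n > 0" using n by simp
  have C_add: "C (k * n + i) = (rot ^^ k) (C i)" for k i
    using n0 by (simp add: C_def funpow_add)
  have twist: "C (i + n) = rot (C i)" for i
    using C_add[of 1 i] by (simp add: add.commute)
  have word: "(w @ take 3 (map rot w @ map (rot \<circ> rot) w)) ! i = C i" if "i < n + 3" for i
  proof -
    consider "i < n" | "n \<le> i" "i - n < n" | "n + n \<le> i" "i - (n + n) < n"
      using \<open>i < n + 3\<close> n by linarith
    then consider "i < n" | j where "i = n + j" "j < n" | j where "i = n + n + j" "j < n"
      by (metis le_add_diff_inverse)
    then show ?thesis
    proof cases
      case 1
      then show ?thesis using len by (simp add: nth_append C_def)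
    next
      case 2
      then have "C i = rot (w ! j)" using twist[of j] by (simp add: C_def add.commute)
      then show ?thesis using 2 len that by (simp add: nth_append)
    next
      case 3
      then have "C i = rot (rot (w ! j))"
        using twist[of j] twist[of "j + n"] by (simp add: C_def ac_simps)
      then show ?thesis using 3 len that by (simp add: nth_append)
    qed
  qed
  have "row_ok (C i) (C (i + 1)) (C (i + 2)) (C (i + 3))" for i
  proof -
    define k j where "k = i div n" and "j = i mod n"
    have i: "i = k * n + j" and j: "j < n"
      using n0 by (simp_all add: k_def j_def)
    have "window_ok (C j) (C (j + 1)) (C (j + 2)) (C (j + 3))"
      using windows_ok_nth[OF ok, of j] word[of j] word[of "j + 1"] word[of "j + 2"] word[of "j + 3"]
        j len n by simp
    from row_ok_twisted[OF this, of k] show ?thesis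
      unfolding i by (simp add: C_add[symmetric] add.assoc)
  qed
  moreover have "palette_ok (C i)" for i
  proof -
    have "palette_ok ((rot ^^ k) D)" if "palette_ok D" for k D
      by (induction k) (use that in \<open>auto simp: palette_ok_def\<close>)
    moreover have "palette_ok (w ! (i mod n))"
      using palette len n0 by simp
    ultimately show ?thesis by (simp add: C_def)
  qed
  ultimately show ?thesis
    using star_edge_coloring_of_columns[of C, OF twist] unfolding palette_ok_def by blast
qed

end

section \<open>Tiles\<close>

text \<open>Triangles with colors 0, 1, 2 and spokes with color 4. From the first column, each row leaves
  by the color of the triangle edge opposite to its inner vertex; from the second column, by color 3.\<close>

definition tile2 :: "column list" where
  "tile2 = [((1, 2, 0), (4, 4, 4), (0, 1, 2)), ((3, 3, 3), (4, 4, 4), (0, 1, 2))]"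

text \<open>In each row the outer edges have three different colors, so this tile can be repeated without a
  rotation: any four consecutive outer edges still show three colors. Like \<open>tile2\<close>, it is left by
  color 3 in every row.\<close>

definition tile3 :: "column list" where
  "tile3 = [((4, 2, 0), (1, 4, 4), (0, 1, 2)), ((0, 1, 4), (2, 3, 2), (4, 0, 1)),
     ((3, 3, 3), (4, 4, 2), (2, 0, 1))]"

lemmas ok_defs = row_ok_def window_ok_def palette_ok_def compatible_def outer_def spoke_def inner_def
  tile2_def tile3_def

text \<open>The windows that start in one copy of the tile end within the next copy, so no new windows arise
  from the third copy on.\<close>

lemma windows_ok_tile3_power:
  assumes "windows_ok (tile3 @ zs)"
  shows "windows_ok (tile3 @ concat (replicate k tile3) @ zs)"
proof (induction k)
  case 0
  show ?case using assms by simp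
next
  case (Suc k)
  then show ?case by (simp add: ok_defs)
qed

text \<open>Two unrotated copies of \<open>tile2\<close> in succession would have outer rows alternating between two colors.
  Therefore the second copy is rotated twice; when \<open>E\<close> is the whole word, the rotation of its
  continuation makes the step to the next copy nontrivial as well. If the word contains
  \<open>tile3\<close>, its continuation starts with a rotated \<open>tile3\<close>, and beyond
  repetitions of \<open>tile3\<close> only the transitions around a single \<open>E\<close> remain to be checked.\<close>

lemma word_of_tiles:
  assumes "E \<in> {[], tile2, tile2 @ map (rot \<circ> rot) tile2}"
    and w: "w = concat (replicate k tile3) @ E" "w \<noteq> []"
  shows "windows_ok (w @ take 3 (map rot w @ map (rot \<circ> rot) w))" "\<forall>C \<in> set w. palette_ok C"
proof -
  show "windows_ok (w @ take 3 (map rot w @ map (rot \<circ> rot) w))"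
  proof (cases k)
    case 0
    then show ?thesis using assms by (auto simp: ok_defs)
  next
    case (Suc k')
    have "take 3 (map rot w @ map (rot \<circ> rot) w) = map rot tile3"
      using w Suc by (simp add: tile3_def)
    moreover have "windows_ok (tile3 @ E @ map rot tile3)"
      using assms(1) by (auto simp: ok_defs)
    ultimately show ?thesis
      using windows_ok_tile3_power[of "E @ map rot tile3" k'] w Suc by simp
  qed
  show "\<forall>C \<in> set w. palette_ok C"
    using assms by (auto simp: ok_defs)
qed

lemma generalized_petersen_five_colorable:
  assumes "n \<ge> 2"
  shows "\<exists>c. star_edge_coloring (generalized_petersen (3 * n) n) 5 c"
proof -
  \<comment> \<open>\<open>n = 1\<close> is the only number of the form \<open>3 k + 1\<close> that is not \<open>3 k + 4\<close>.\<close>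
  have "n mod 3 = 0 \<or> n mod 3 = 2 \<or> n mod 3 = 1" by auto
  then have "(\<exists>k. n = 3 * k) \<or> (\<exists>k. n = 3 * k + 2) \<or> (\<exists>k. n = 3 * k + 4)"
    using assms by presburger
  then consider k where "n = 3 * k" | k where "n = 3 * k + 2" | k where "n = 3 * k + 4"
    by blast
  then obtain k E where "E \<in> {[], tile2, tile2 @ map (rot \<circ> rot) tile2}" "n = 3 * k + length E"
    by cases (force simp: tile2_def)+
  moreover define w where "w = concat (replicate k tile3) @ E"
  moreover have "length (concat (replicate k tile3)) = 3 * k"
    by (induction k) (auto simp: tile3_def)
  ultimately have "length w = n" and E: "E \<in> {[], tile2, tile2 @ map (rot \<circ> rot) tile2}"
    by simp_all
  then show ?thesis
    using star_edge_coloring_of_word[OF assms] word_of_tiles[OF E w_def] assms by fastforce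
qed

theorem theorem4p1:
  fixes n :: nat
  assumes "n \<ge> 2"
  shows "star_chromatic_index (generalized_petersen (3 * n) n) = 5"
  unfolding star_chromatic_index_def
proof (rule Least_equality)
  show "\<exists>c. star_edge_coloring (generalized_petersen (3 * n) n) 5 c"
    using generalized_petersen_five_colorable[OF assms] .
  show "5 \<le> k" if "\<exists>c. star_edge_coloring (generalized_petersen (3 * n) n) k c" for k
    using generalized_petersen_needs_five_colors[OF assms] that by blast
qed

end
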